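(* The $5 \times 5$ knight's framework in $\mathbb{R}^2$ is infinitesimally rigid.
   Context: A framework in $\mathbb{R}^d$ is a finite graph whose vertices (called joints) are distinct points of $\mathbb{R}^d$ and whose edges (called bars) are line segments between pairs of joints. An infinitesimal motion of $\mathbb{R}^d$ is a map $f:\mathbb{R}^d\to\mathbb{R}^d$ with $(f(x)-f(y))\cdot(x-y)=0$ for all $x,y\in\mathbb{R}^d$. If $F$ is a framework with joint set $X$, an infinitesimal motion of $F$ is a map $g:X\to\mathbb{R}^d$ with $(g(x)-g(y))\cdot(x-y)=0$ for every bar $xy$ of $F$. $F$ is infinitesimally rigid if every infinitesimal motion of $F$ is the restriction to $X$ of some infinitesimal motion of $\mathbb{R}^d$. The $m\times n$ knight's framework in $\mathbb{R}^2$ has a joint at every integer point $(x,y)$ with $0\le x\le m-1$, $0\le y\le n-1$, and a bar between $(x_1,y_1)$ and $(x_2,y_2)$ exactly when $|x_1-x_2|=1,|y_1-y_2|=2$ or $|x_1-x_2|=2,|y_1-y_2|=1$. *)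

theory Defs
  imports "HOL-Analysis.Analysis"
begin

text \<open>A framework in R^d (here: any Euclidean space 'a) is given by its finite joint set X
  and its bar set, a symmetric relation on X given as a set of pairs.\<close>

definition inf_motion_space :: "('a::euclidean_space \<Rightarrow> 'a) \<Rightarrow> bool" where
  "inf_motion_space f \<longleftrightarrow> (\<forall>x y. (f x - f y) \<bullet> (x - y) = 0)"

definition inf_motion_framework ::
  "'a::euclidean_space set \<Rightarrow> ('a \<times> 'a) set \<Rightarrow> ('a \<Rightarrow> 'a) \<Rightarrow> bool" where
  "inf_motion_framework X B g \<longleftrightarrow> (\<forall>(x, y) \<in> B. (g x - g y) \<bullet> (x - y) = 0)"

text \<open>Motions of the framework are maps X -> R^d; we represent them as total functions
  and only their values on X matter (both for the motion condition, as bars join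
  joints, and for the rigidity conclusion).\<close>

definition inf_rigid :: "'a::euclidean_space set \<Rightarrow> ('a \<times> 'a) set \<Rightarrow> bool" where
  "inf_rigid X B \<longleftrightarrow>
     (\<forall>g. inf_motion_framework X B g \<longrightarrow>
        (\<exists>f. inf_motion_space f \<and> (\<forall>x\<in>X. f x = g x)))"

definition pt :: "int \<Rightarrow> int \<Rightarrow> real^2" where
  "pt a b = vector [real_of_int a, real_of_int b]"

definition knight_joints :: "nat \<Rightarrow> nat \<Rightarrow> (real^2) set" where
  "knight_joints m n = {pt a b | a b. 0 \<le> a \<and> a \<le> int m - 1 \<and> 0 \<le> b \<and> b \<le> int n - 1}"

definition knight_bars :: "nat \<Rightarrow> nat \<Rightarrow> ((real^2) \<times> (real^2)) set" where
  "knight_bars m n = {p. \<exists>a1 b1 a2 b2 :: int. p = (pt a1 b1, pt a2 b2) \<and>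
      0 \<le> a1 \<and> a1 \<le> int m - 1 \<and> 0 \<le> b1 \<and> b1 \<le> int n - 1 \<and>
      0 \<le> a2 \<and> a2 \<le> int m - 1 \<and> 0 \<le> b2 \<and> b2 \<le> int n - 1 \<and>
      ((\<bar>a1 - a2\<bar> = 1 \<and> \<bar>b1 - b2\<bar> = 2) \<or> (\<bar>a1 - a2\<bar> = 2 \<and> \<bar>b1 - b2\<bar> = 1))}"

end

(* After subtraction of a rigid motion, the centre and the direction to one of its neighbours are
   fixed.  A motion fixing the centre turns each of its eight neighbours by one real parameter.  The bars to these
   neighbours determine the eight joints of the centre's colour other than the corners, and each
   of the four remaining non-corner joints is then joined to four determined joints, which gives
   two linear conditions on the parameters.  These eight conditions force all parameters
   to vanish. *)
theory Submission
  imports Defs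
begin

text \<open>Here \<open>u\<close> and \<open>v\<close> are the two coordinates of a motion. The only
  motion of the plane with \<open>u 2 2 = v 2 2 = u 0 1 = 0\<close> is zero, so these three
  equations remove exactly the rigid motions.\<close>

lemma knight_5_5_motion_zero:
  fixes u v :: "int \<Rightarrow> int \<Rightarrow> real"
  assumes bar: "\<And>a b c d. \<lbrakk>a \<in> {0..4}; b \<in> {0..4}; c \<in> {0..4}; d \<in> {0..4};
      \<bar>a - c\<bar> = 1 \<and> \<bar>b - d\<bar> = 2 \<or> \<bar>a - c\<bar> = 2 \<and> \<bar>b - d\<bar> = 1\<rbrakk>
      \<Longrightarrow> of_int (a - c) * (u a b - u c d) + of_int (b - d) * (v a b - v c d) = 0"
    and "u 2 2 = 0" "v 2 2 = 0" "u 0 1 = 0"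
    and "a \<in> {0..4}" "b \<in> {0..4}"
  shows "u a b = 0 \<and> v a b = 0"
proof -
  \<comment> \<open>At each neighbour of the centre the kept parameter is the coordinate of which
    the other is an integer multiple. At (0,1) it vanishes by assumption, so seven remain.\<close>
  have nb: "v 0 1 = 0" "v 0 3 = 2 * u 0 3" "v 4 1 = 2 * u 4 1" "v 4 3 = -2 * u 4 3"
    "u 1 0 = -2 * v 1 0" "u 1 4 = 2 * v 1 4" "u 3 0 = 2 * v 3 0" "u 3 4 = -2 * v 3 4"
    using bar[of 0 1 2 2] bar[of 0 3 2 2] bar[of 4 1 2 2] bar[of 4 3 2 2]
      bar[of 1 0 2 2] bar[of 1 4 2 2] bar[of 3 0 2 2] bar[of 3 4 2 2] assms(2-4)
    by simp_all
  \<comment> \<open>Each joint in \<open>mid\<close> and \<open>diag\<close> has bars in two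
    independent directions to neighbours of the centre, which fix its velocity.\<close>
  have mid: "u 2 0 = u 4 1" "v 2 0 = 2 * u 4 1"
    "u 2 4 = u 0 3 + u 4 3" "v 2 4 = 2 * (u 0 3 - u 4 3)"
    "u 0 2 = 2 * (v 1 4 - v 1 0)" "v 0 2 = v 1 0 + v 1 4"
    "u 4 2 = 2 * (v 3 0 - v 3 4)" "v 4 2 = v 3 0 + v 3 4"
    using bar[of 2 0 0 1] bar[of 2 0 4 1] bar[of 2 4 0 3] bar[of 2 4 4 3]
      bar[of 0 2 1 0] bar[of 0 2 1 4] bar[of 4 2 3 0] bar[of 4 2 3 4] assms(4)
    by (simp_all add: nb)
  have diag: "u 1 1 = u 0 3 + 2 * v 3 0" "v 1 1 = 2 * u 0 3 + v 3 0"
    "u 3 1 = u 4 3 - 2 * v 1 0" "v 3 1 = v 1 0 - 2 * u 4 3"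
    "u 1 3 = - 2 * v 3 4" "v 1 3 = v 3 4"
    "u 3 3 = u 4 1 + 2 * v 1 4" "v 3 3 = 2 * u 4 1 + v 1 4"
    using bar[of 1 1 3 0] bar[of 1 1 0 3] bar[of 3 1 1 0] bar[of 3 1 4 3]
      bar[of 1 3 3 4] bar[of 1 3 0 1] bar[of 3 3 1 4] bar[of 3 3 4 1] assms(4)
    by (simp_all add: nb)
  note inner = assms(4) nb mid diag
  \<comment> \<open>The four bars at (2,1) give the values of 2u-v, 2u+v, u-2v and u+2v there. Sums
    and differences yield two expressions for 4u and two for 4v; equating them eliminates the
    velocity of (2,1). The joints (2,3), (1,2) and (3,2) are treated alike below.\<close>
  have c1: "2 * u 0 2 - v 0 2 + 2 * u 4 2 + v 4 2 = 2 * (u 1 3 - 2 * v 1 3 + u 3 3 + 2 * v 3 3)"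
    "2 * (2 * u 4 2 + v 4 2 - 2 * u 0 2 + v 0 2) = u 3 3 + 2 * v 3 3 - u 1 3 + 2 * v 1 3"
    using bar[of 2 1 0 2] bar[of 2 1 4 2] bar[of 2 1 1 3] bar[of 2 1 3 3] by simp_all
  have c2: "2 * u 0 2 + v 0 2 + 2 * u 4 2 - v 4 2 = 2 * (u 1 1 + 2 * v 1 1 + u 3 1 - 2 * v 3 1)"
    "2 * (2 * u 0 2 + v 0 2 - 2 * u 4 2 + v 4 2) = u 1 1 + 2 * v 1 1 - u 3 1 + 2 * v 3 1"
    using bar[of 2 3 0 2] bar[of 2 3 4 2] bar[of 2 3 1 1] bar[of 2 3 3 1] by simp_all
  have c3: "2 * v 2 0 - u 2 0 + 2 * v 2 4 + u 2 4 = 2 * (v 3 1 - 2 * u 3 1 + v 3 3 + 2 * u 3 3)"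
    "2 * (2 * v 2 4 + u 2 4 - 2 * v 2 0 + u 2 0) = v 3 3 + 2 * u 3 3 - v 3 1 + 2 * u 3 1"
    using bar[of 1 2 2 0] bar[of 1 2 2 4] bar[of 1 2 3 1] bar[of 1 2 3 3] by simp_all
  have c4: "2 * v 2 0 + u 2 0 + 2 * v 2 4 - u 2 4 = 2 * (v 1 1 + 2 * u 1 1 + v 1 3 - 2 * u 1 3)"
    "2 * (2 * v 2 0 + u 2 0 - 2 * v 2 4 + u 2 4) = v 1 1 + 2 * u 1 1 - v 1 3 + 2 * u 1 3"
    using bar[of 3 2 2 0] bar[of 3 2 2 4] bar[of 3 2 1 1] bar[of 3 2 1 3] by simp_all
  note c = c1 c2 c3 c4
  \<comment> \<open>Rewriting with \<open>inner\<close> leaves eight homogeneous linear equations in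
    the seven parameters.\<close>
  have params: "u 0 3 = 0" "u 4 1 = 0" "u 4 3 = 0" "v 1 0 = 0" "v 1 4 = 0" "v 3 0 = 0" "v 3 4 = 0"
    using c unfolding inner by argo+
  note zero = assms(2-4) params nb[unfolded params] mid[unfolded params] diag[unfolded params]
  have edge: "u 2 1 = 0" "v 2 1 = 0" "u 2 3 = 0" "v 2 3 = 0"
    "u 1 2 = 0" "v 1 2 = 0" "u 3 2 = 0" "v 3 2 = 0"
    using bar[of 2 1 0 2] bar[of 2 1 4 2] bar[of 2 3 0 2] bar[of 2 3 4 2]
      bar[of 1 2 2 0] bar[of 1 2 2 4] bar[of 3 2 2 0] bar[of 3 2 2 4]
    by (simp_all add: zero)
  \<comment> \<open>A corner has just two bars, both ending at joints settled in
    \<open>edge\<close>; their directions are independent.\<close>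
  have corner: "u 0 0 = 0" "v 0 0 = 0" "u 0 4 = 0" "v 0 4 = 0"
    "u 4 0 = 0" "v 4 0 = 0" "u 4 4 = 0" "v 4 4 = 0"
    using bar[of 0 0 2 1] bar[of 0 0 1 2] bar[of 0 4 2 3] bar[of 0 4 1 2]
      bar[of 4 0 2 1] bar[of 4 0 3 2] bar[of 4 4 2 3] bar[of 4 4 3 2]
    by (simp_all add: edge)
  have "a \<in> {0,1,2,3,4}" "b \<in> {0,1,2,3,4}"
    using assms(5,6) by auto
  then show ?thesis
    using zero edge corner by auto
qed

theorem theorem2:
  shows "inf_rigid (knight_joints 5 5) (knight_bars 5 5)"
  unfolding inf_rigid_def
proof (intro allI impI)
  fix g
  assume g: "inf_motion_framework (knight_joints 5 5) (knight_bars 5 5) g"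
  define u v where "u a b = g (pt a b) $ 1" and "v a b = g (pt a b) $ 2" for a b
  \<comment> \<open>The field \<open>f\<close> is a translation plus a rotation about the centre
    (2,2). Its angular velocity \<open>w\<close> makes the first coordinates of \<open>f\<close> and
    \<open>g\<close> agree at (0,1).\<close>
  define w where "w = u 0 1 - u 2 2"
  define f :: "real^2 \<Rightarrow> real^2"
    where "f p = vector [u 2 2 - w * (p $ 2 - 2), v 2 2 + w * (p $ 1 - 2)]" for p
  have bar: "of_int (a - c) * (u a b - u c d) + of_int (b - d) * (v a b - v c d) = 0"
    if "a \<in> {0..4}" "b \<in> {0..4}" "c \<in> {0..4}" "d \<in> {0..4}"
      "\<bar>a - c\<bar> = 1 \<and> \<bar>b - d\<bar> = 2 \<or> \<bar>a - c\<bar> = 2 \<and> \<bar>b - d\<bar> = 1" for a b c d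
  proof -
    have "(pt a b, pt c d) \<in> knight_bars 5 5"
      unfolding knight_bars_def using that by (simp, blast)
    then have "(g (pt a b) - g (pt c d)) \<bullet> (pt a b - pt c d) = 0"
      using g unfolding inf_motion_framework_def by blast
    then show ?thesis
      by (simp add: inner_vec_def sum_2 pt_def u_def v_def mult.commute)
  qed
  \<comment> \<open>The bar equations are linear and \<open>f\<close> satisfies them, so the
    normalised lemma applies to \<open>g - f\<close>.\<close>
  have "u a b - f (pt a b) $ 1 = 0 \<and> v a b - f (pt a b) $ 2 = 0"
    if "a \<in> {0..4}" "b \<in> {0..4}" for a b
  proof (rule knight_5_5_motion_zero[OF _ _ _ _ that])
    fix a b c d :: int
    assume "a \<in> {0..4}" "b \<in> {0..4}" "c \<in> {0..4}" "d \<in> {0..4}"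
      "\<bar>a - c\<bar> = 1 \<and> \<bar>b - d\<bar> = 2 \<or> \<bar>a - c\<bar> = 2 \<and> \<bar>b - d\<bar> = 1"
    from bar[OF this]
    show "of_int (a - c) * (u a b - f (pt a b) $ 1 - (u c d - f (pt c d) $ 1)) +
        of_int (b - d) * (v a b - f (pt a b) $ 2 - (v c d - f (pt c d) $ 2)) = 0"
      by (simp add: f_def pt_def algebra_simps)
  qed (simp_all add: f_def pt_def w_def)
  then have "f (pt a b) = g (pt a b)" if "a \<in> {0..4}" "b \<in> {0..4}" for a b
    using that by (simp add: vec_eq_iff forall_2 u_def v_def)
  then have "\<forall>x\<in>knight_joints 5 5. f x = g x"
    by (auto simp: knight_joints_def)
  moreover have "inf_motion_space f"
    by (simp add: inf_motion_space_def f_def inner_vec_def sum_2 algebra_simps)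
  ultimately show "\<exists>f. inf_motion_space f \<and> (\<forall>x\<in>knight_joints 5 5. f x = g x)"
    by blast
qed
end
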